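(* Let $N\ge 1$ and let $a,b$ be distinct integers with $\gcd(N,a,b)=1$, and suppose the double-step graph $G(N;\pm a,\pm b)$ has diameter $k$. Let $N\!A$ be the New Amsterdam digraph on $2N$ vertices with steps $$\alpha=-1,\qquad \beta=2(b-a)-1,\qquad \gamma=2a+1,\qquad \delta=-2b+1,$$ that is, the digraph with vertex set $\mathbb{Z}_{2N}$ in which every even vertex $i$ has arcs to $i+\alpha$ and $i+\beta$, and every odd vertex $j$ has arcs to $j+\gamma$ and $j+\delta$ (arithmetic modulo $2N$). Then the diameter $D_{NA}$ of $N\!A$ satisfies $$2k\le D_{NA}\le 2k+1.$$
   Context: A double-step graph $G(N;\pm a,\pm b)$ has vertex set $\mathbb{Z}_N$, and each vertex $i$ is adjacent to $i\pm a$ and $i\pm b$ (mod $N$), where $a,b$ are distinct integers (the steps) with $\gcd(N,a,b)=1$; its diameter is the usual graph diameter. A New Amsterdam digraph $N\!A(M;\alpha,\beta,\gamma,\delta)$, for even $M$ and odd integers $\alpha\neq\beta,\gamma,\delta$ with $\alpha+\beta+\gamma+\delta\equiv 0 \pmod M$, is the bipartite digraph on $\mathbb{Z}_M$ where each even vertex $i$ has arcs to $i+\alpha,i+\beta$ and each odd vertex $j$ has arcs to $j+\gamma,j+\delta$ (mod $M$). The diameter of a digraph is the maximum, over ordered pairs of vertices $(u,v)$, of the length of a shortest directed path from $u$ to $v$. *)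

theory Defs
  imports "Graph_Theory.Graph_Theory" "HOL-Library.Extended_Nat"
begin

text \<open>
  Distances are extended naturals: the infimum over the empty set is \<open>\<infinity>\<close>, so a digraph that is
  not strongly connected has diameter \<open>\<infinity>\<close>. On a finite nonempty vertex set the supremum
  in the diameter is a maximum.
\<close>

definition digraph_dist :: "('a, 'b) pre_digraph \<Rightarrow> 'a \<Rightarrow> 'a \<Rightarrow> enat" where
  "digraph_dist G u v = (INF p \<in> {p. pre_digraph.apath G u p v}. enat (length p))"

definition digraph_diameter :: "('a, 'b) pre_digraph \<Rightarrow> enat" where
  "digraph_diameter G = (SUP (u, v) \<in> verts G \<times> verts G. digraph_dist G u v)"

text \<open>
  The integers modulo \<open>N\<close> are represented by \<open>{0..<int N}\<close>. As usual in \<^theory>\<open>Graph_Theory.Digraph\<close>,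
  an undirected graph is a symmetric digraph. Loops or coinciding arcs, which occur when the steps
  degenerate modulo \<open>N\<close>, do not affect distances.
\<close>

definition double_step_graph :: "nat \<Rightarrow> int \<Rightarrow> int \<Rightarrow> int pair_pre_digraph" where
  "double_step_graph N a b =
     \<lparr> pverts = {0..<int N},
       parcs = {(i, (i + s) mod int N) | i s. i \<in> {0..<int N} \<and> s \<in> {a, - a, b, - b}} \<rparr>"

text \<open>
  Meant for even \<open>M\<close> and odd steps; then the parity of a residue class modulo \<open>M\<close> is that of its
  representative in \<open>{0..<int M}\<close>.
\<close>

definition new_amsterdam :: "nat \<Rightarrow> int \<Rightarrow> int \<Rightarrow> int \<Rightarrow> int \<Rightarrow> int pair_pre_digraph" where
  "new_amsterdam M \<alpha> \<beta> \<gamma> \<delta> =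
     \<lparr> pverts = {0..<int M},
       parcs = {(i, (i + s) mod int M) | i s. i \<in> {0..<int M} \<and> even i \<and> s \<in> {\<alpha>, \<beta>}}
             \<union> {(j, (j + s) mod int M) | j s. j \<in> {0..<int M} \<and> odd j \<and> s \<in> {\<gamma>, \<delta>}} \<rparr>"

lemma pair_sym_digraph_double_step_graph: "pair_sym_digraph (double_step_graph N a b)"
proof unfold_locales
  have "(v, u) \<in> parcs (double_step_graph N a b)" if "(u, v) \<in> parcs (double_step_graph N a b)" for u v
  proof -
    from that obtain s where s: "u \<in> {0..<int N}" "s \<in> {a, - a, b, - b}" "v = (u + s) mod int N"
      by (auto simp: double_step_graph_def)
    have "(v + - s) mod int N = u"
      using s(1) by (simp add: s(3) mod_diff_left_eq)
    moreover have "- s \<in> {a, - a, b, - b}" "v \<in> {0..<int N}"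
      using s by auto
    ultimately show ?thesis
      unfolding double_step_graph_def by (auto intro!: exI[of _ "- s"])
  qed
  then show "symmetric (with_proj (double_step_graph N a b))"
    by (auto simp: symmetric_def sym_def)
qed (auto simp: double_step_graph_def)

lemma pair_wf_digraph_new_amsterdam: "pair_wf_digraph (new_amsterdam M \<alpha> \<beta> \<gamma> \<delta>)"
  by unfold_locales (auto simp: new_amsterdam_def)

end

theory Submission
  imports Defs
begin

text \<open>
  In the New Amsterdam digraph every vertex has exactly the four two-step displacements
  \<open>\<plusminus>2a\<close>, \<open>\<plusminus>2b\<close>: the sums \<open>\<alpha> + \<gamma>\<close>, \<open>\<beta> + \<delta>\<close>, \<open>\<beta> + \<gamma>\<close>, \<open>\<alpha> + \<delta>\<close>. So its square consists of two
  copies of the double-step graph, one on the even and one on the odd vertices, and every arc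
  changes the parity. A distance \<open>k\<close> in the double-step graph therefore becomes \<open>2k\<close> between
  vertices of equal parity, and vertices of different parity need at most one additional arc.
\<close>

lemma (in wf_digraph) awalk_exists_iff_relpow:
  "(\<exists>p. awalk u p v \<and> length p = n) \<longleftrightarrow> u \<in> verts G \<and> (u, v) \<in> arcs_ends G ^^ n"
proof (induction n arbitrary: u)
  \<comment> \<open>The conjunct on \<open>u\<close> matters here: the zeroth power is the identity
    on the whole type, whereas an empty walk must start at a vertex.\<close>
  case 0
  then show ?case by (auto simp: awalk_def)
next
  case (Suc n)
  have "(\<exists>p. awalk u p v \<and> length p = Suc n) \<longleftrightarrow>
      (\<exists>e p. e \<in> arcs G \<and> u = tail G e \<and> awalk (head G e) p v \<and> length p = n)"
    by (auto simp: length_Suc_conv awalk_Cons_iff) (metis awalk_Cons_iff length_Cons)+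
  also have "\<dots> \<longleftrightarrow> (\<exists>e. e \<in> arcs G \<and> u = tail G e \<and> (head G e, v) \<in> arcs_ends G ^^ n)"
    using Suc.IH by (metis head_in_verts)
  also have "\<dots> \<longleftrightarrow> u \<in> verts G \<and> (u, v) \<in> arcs_ends G ^^ Suc n"
    by (auto simp: arcs_ends_conv elim!: relpow_Suc_E2 simp del: relpow.simps
        intro!: relpow_Suc_I2)
  finally show ?case .
qed

lemma (in wf_digraph) awalk_to_apath_length:
  assumes "awalk u p v"
  shows "length (awalk_to_apath p) \<le> length p"
  using assms
proof (induct rule: awalk_to_apath_induct)
  case (path p)
  then have "awalk_to_apath p = p"
    by (auto simp: awalk_to_apath.simps)
  then show ?case by simp
next
  case (decomp p q r s)
  then have "p = q @ r @ s"
    by (auto dest: awalk_cyc_decomp_has_prop)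
  with decomp show ?case using step_awalk_to_apath[of _ p _ q r s] by simp
qed

text \<open>Removing cycles never lengthens a walk, so the infimum over simple paths is bounded by
  \<open>n\<close> as soon as some walk has length at most \<open>n\<close>. This replaces paths by
  relational powers, which are easier to split and compose.\<close>

lemma (in wf_digraph) digraph_dist_le_iff:
  assumes "u \<in> verts G"
  shows "digraph_dist G u v \<le> enat n \<longleftrightarrow> (\<exists>m\<le>n. (u, v) \<in> arcs_ends G ^^ m)"
proof
  assume "digraph_dist G u v \<le> enat n"
  \<comment> \<open>A strict bound on an infimum yields a witness directly.\<close>
  then have "digraph_dist G u v < enat (Suc n)"
    by (meson enat_ord_simps(2) le_less_trans lessI)
  then obtain p where "apath u p v" "length p < Suc n"
    unfolding digraph_dist_def by (auto simp: INF_less_iff)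
  then show "\<exists>m\<le>n. (u, v) \<in> arcs_ends G ^^ m"
    using awalk_exists_iff_relpow by (metis awalkI_apath less_Suc_eq_le)
next
  assume "\<exists>m\<le>n. (u, v) \<in> arcs_ends G ^^ m"
  then obtain p where p: "awalk u p v" "length p \<le> n"
    using awalk_exists_iff_relpow assms by metis
  then have "apath u (awalk_to_apath p) v" "length (awalk_to_apath p) \<le> n"
    using apath_awalk_to_apath awalk_to_apath_length by (blast intro: le_trans)+
  then show "digraph_dist G u v \<le> enat n"
    unfolding digraph_dist_def by (auto intro!: INF_lower2)
qed

lemma (in pair_wf_digraph) digraph_diameter_le_iff:
  "digraph_diameter (with_proj G) \<le> enat n \<longleftrightarrow>
     (\<forall>u \<in> pverts G. \<forall>v \<in> pverts G. \<exists>m\<le>n. (u, v) \<in> parcs G ^^ m)"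
  by (auto simp: digraph_diameter_def SUP_le_iff digraph_dist_le_iff)

text \<open>Reduction modulo \<open>2 * n\<close> keeps the parity bit \<open>p\<close> and reduces
  the half modulo \<open>n\<close>; this links the two vertex sets.\<close>

lemma double_mod:
  fixes x p :: int
  assumes "p \<in> {0, 1}" "n > 0"
  shows "(2 * x + p) mod (2 * n) = 2 * (x mod n) + p"
proof -
  have "(2 * x + p) mod (2 * n) = 2 * ((2 * x + p) div 2 mod n) + (2 * x + p) mod 2"
    using \<open>n > 0\<close> by (intro zmod_zmult2_eq) simp
  then show ?thesis using assms(1) by auto
qed

context
  fixes N :: nat and a b :: int and E R :: "int rel"
  assumes N: "N > 0"
  defines "E \<equiv> parcs (double_step_graph N a b)"
  defines "R \<equiv> parcs (new_amsterdam (2 * N) (- 1) (2 * (b - a) - 1) (2 * a + 1) (- 2 * b + 1))"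
begin

text \<open>All four steps are odd, and reduction modulo the even number \<open>2 * N\<close>
  preserves parity.\<close>

lemma new_amsterdam_arc_parity: "(u, v) \<in> R \<Longrightarrow> even v \<longleftrightarrow> odd u"
  by (auto simp: R_def new_amsterdam_def dvd_mod_iff)

lemma new_amsterdam_relpow_parity: "(u, v) \<in> R ^^ n \<Longrightarrow> even v \<longleftrightarrow> (even u \<longleftrightarrow> even n)"
  by (induction n arbitrary: v) (auto dest: new_amsterdam_arc_parity)

lemma new_amsterdam_two_steps:
  "(u, w) \<in> R ^^ 2 \<longleftrightarrow>
     u \<in> {0..<2 * int N} \<and> (\<exists>x \<in> {a, - a, b, - b}. w = (u + 2 * x) mod (2 * int N))"
proof -
  define M where "M = 2 * int N"
  have "even M" "M > 0" using N by (auto simp: M_def)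
  define S where "S = (\<lambda>u :: int. if even u then {- 1, 2 * (b - a) - 1} else {2 * a + 1, - 2 * b + 1})"
  have R: "(u, v) \<in> R \<longleftrightarrow> u \<in> {0..<M} \<and> (\<exists>s \<in> S u. v = (u + s) mod M)" for u v
    unfolding R_def new_amsterdam_def S_def M_def pair_pre_digraph.simps of_nat_mult of_nat_numeral
    by (cases "even u"; simp only: if_True if_False; blast)
  have "(u, w) \<in> R ^^ 2 \<longleftrightarrow> (\<exists>v. (u, v) \<in> R \<and> (v, w) \<in> R)"
    by (auto simp: numeral_2_eq_2)
  also have "\<dots> \<longleftrightarrow> u \<in> {0..<M} \<and> (\<exists>s \<in> S u. \<exists>t \<in> S ((u + s) mod M). w = (u + s + t) mod M)"
  proof -
    have "(u + s) mod M \<in> {0..<M}" "((u + s) mod M + t) mod M = (u + s + t) mod M" for s t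
      using \<open>M > 0\<close> by (auto simp: mod_add_left_eq)
    then show ?thesis unfolding R by metis
  qed
  \<comment> \<open>\<open>S\<close> depends only on parity, and the intermediate vertex has the
    parity of \<open>u + 1\<close>.\<close>
  also have "\<dots> \<longleftrightarrow> u \<in> {0..<M} \<and> (\<exists>s \<in> S u. \<exists>t \<in> S (u + 1). w = (u + s + t) mod M)"
    using \<open>even M\<close> by (auto simp: S_def dvd_mod_iff)
  also have "\<dots> \<longleftrightarrow> u \<in> {0..<M} \<and> (\<exists>x \<in> {a, - a, b, - b}. w = (u + 2 * x) mod M)"
    by (auto simp: S_def algebra_simps)
  finally show ?thesis by (simp add: M_def)
qed

text \<open>The map sending \<open>i\<close> to \<open>2 * i + p\<close> identifies the residues
  modulo \<open>N\<close> with the vertices of parity \<open>p\<close>, and turns a displacement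
  \<open>x\<close> into \<open>2 * x\<close>.\<close>

lemma new_amsterdam_square:
  assumes "i \<in> {0..<int N}" "p \<in> {0, 1}"
  shows "(2 * i + p, w) \<in> R ^^ 2 \<longleftrightarrow> (\<exists>j. w = 2 * j + p \<and> (i, j) \<in> E)"
proof -
  have "(2 * i + p + 2 * x) mod (2 * int N) = 2 * ((i + x) mod int N) + p" for x
    using double_mod[of p "int N" "i + x"] assms N by (simp add: algebra_simps)
  moreover have "2 * i + p \<in> {0..<2 * int N}"
    using assms by auto
  moreover have "(i, j) \<in> E \<longleftrightarrow> (\<exists>x \<in> {a, - a, b, - b}. j = (i + x) mod int N)" for j
    using assms(1) unfolding E_def double_step_graph_def pair_pre_digraph.simps by blast
  ultimately show ?thesis
    unfolding new_amsterdam_two_steps by metis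
qed

text \<open>Induction that splits off the first two arcs, i.e. one edge of \<open>E\<close>. The
  upper bound uses this from right to left, the lower bound from left to right.\<close>

lemma new_amsterdam_even_relpow:
  assumes "i \<in> {0..<int N}" "p \<in> {0, 1}"
  shows "(2 * i + p, 2 * j + p) \<in> R ^^ (2 * n) \<longleftrightarrow> (i, j) \<in> E ^^ n"
  using assms(1)
proof (induction n arbitrary: i)
  case 0
  then show ?case by auto
next
  case (Suc n)
  have E: "i' \<in> {0..<int N}" if "(i, i') \<in> E" for i'
    using that N by (auto simp: E_def double_step_graph_def)
  have "R ^^ (2 * Suc n) = R ^^ 2 O R ^^ (2 * n)"
    by (simp flip: relpow_add)
  then have "(2 * i + p, 2 * j + p) \<in> R ^^ (2 * Suc n) \<longleftrightarrow>
      (\<exists>i'. (i, i') \<in> E \<and> (2 * i' + p, 2 * j + p) \<in> R ^^ (2 * n))"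
    using new_amsterdam_square[OF Suc.prems assms(2)] by (auto simp: relcomp_unfold)
  also have "\<dots> \<longleftrightarrow> (\<exists>i'. (i, i') \<in> E \<and> (i', j) \<in> E ^^ n)"
    using Suc.IH E by blast
  also have "\<dots> \<longleftrightarrow> (i, j) \<in> E ^^ Suc n"
    by (auto intro: relpow_Suc_I2 elim: relpow_Suc_E2 simp del: relpow.simps)
  finally show ?case .
qed

lemma new_amsterdam_upper:
  assumes "\<forall>i \<in> {0..<int N}. \<forall>j \<in> {0..<int N}. \<exists>m\<le>k. (i, j) \<in> E ^^ m"
    and u: "u \<in> {0..<2 * int N}" and v: "v \<in> {0..<2 * int N}"
  shows "\<exists>m\<le>2 * k + 1. (u, v) \<in> R ^^ m"
proof -
  \<comment> \<open>The start is kept arbitrary, since for unequal parities the claim is applied to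
    an out-neighbour of the given \<open>u\<close>.\<close>
  have same: "\<exists>m\<le>2 * k. (u, v) \<in> R ^^ m"
    if "u \<in> {0..<2 * int N}" "even u \<longleftrightarrow> even v" for u
  proof -
    define p where "p = v mod 2"
    have p: "p \<in> {0, 1}" "u = 2 * (u div 2) + p" "v = 2 * (v div 2) + p"
      using that(2) by (auto simp: p_def mod_2_eq_odd)
    have i: "u div 2 \<in> {0..<int N}" "v div 2 \<in> {0..<int N}"
      using that(1) v by auto
    with assms(1) obtain m where "m \<le> k" "(u div 2, v div 2) \<in> E ^^ m" by blast
    then have "(u, v) \<in> R ^^ (2 * m)"
      using new_amsterdam_even_relpow[OF i(1) p(1)] p(2,3) by metis
    then show ?thesis using \<open>m \<le> k\<close> by (intro exI[of _ "2 * m"]) simp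
  qed
  show ?thesis
  proof (cases "even u \<longleftrightarrow> even v")
    case True
    then show ?thesis using same[OF u] by (meson le_add1 le_trans)
  next
    case False
    obtain w where w: "(u, w) \<in> R" "w \<in> {0..<2 * int N}"
      using u N by (cases "even u") (fastforce simp: R_def new_amsterdam_def)+
    then obtain m where "m \<le> 2 * k" "(w, v) \<in> R ^^ m"
      using same False new_amsterdam_arc_parity by blast
    then show ?thesis using w(1) by (intro exI[of _ "Suc m"]) (auto intro: relpow_Suc_I2 simp del: relpow.simps)
  qed
qed

text \<open>It suffices to test the even vertices \<open>2 * i\<close> and \<open>2 * j\<close>:
  walks between them have even length, so rounding \<open>d\<close> down to an even number loses
  nothing.\<close>

lemma new_amsterdam_lower:
  assumes "\<forall>u \<in> {0..<2 * int N}. \<forall>v \<in> {0..<2 * int N}. \<exists>m\<le>d. (u, v) \<in> R ^^ m"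
    and i: "i \<in> {0..<int N}" and j: "j \<in> {0..<int N}"
  shows "\<exists>m\<le>d div 2. (i, j) \<in> E ^^ m"
proof -
  obtain m where m: "m \<le> d" "(2 * i, 2 * j) \<in> R ^^ m"
    using assms by fastforce
  then have "even m" using new_amsterdam_relpow_parity by fastforce
  then obtain l where l: "m = 2 * l" by blast
  then have "(i, j) \<in> E ^^ l"
    using m(2) new_amsterdam_even_relpow[OF i, of 0 j l] by simp
  then show ?thesis using m(1) l by (intro exI[of _ l]) auto
qed

end

theorem theorem3p1:
  fixes N k :: nat and a b :: int
  assumes "N \<ge> 1" and "a \<noteq> b" and "gcd (int N) (gcd a b) = 1"
    and "digraph_diameter (with_proj (double_step_graph N a b)) = enat k"
  shows "enat (2 * k)
           \<le> digraph_diameter (with_proj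
               (new_amsterdam (2 * N) (- 1) (2 * (b - a) - 1) (2 * a + 1) (- 2 * b + 1)))
       \<and> digraph_diameter (with_proj
               (new_amsterdam (2 * N) (- 1) (2 * (b - a) - 1) (2 * a + 1) (- 2 * b + 1)))
           \<le> enat (2 * k + 1)"
proof -
  define G where "G = double_step_graph N a b"
  define A where "A = new_amsterdam (2 * N) (- 1) (2 * (b - a) - 1) (2 * a + 1) (- 2 * b + 1)"
  interpret G: pair_sym_digraph G
    unfolding G_def by (rule pair_sym_digraph_double_step_graph)
  interpret A: pair_wf_digraph A
    unfolding A_def by (rule pair_wf_digraph_new_amsterdam)
  have verts: "pverts G = {0..<int N}" "pverts A = {0..<2 * int N}"
    by (simp_all add: G_def A_def double_step_graph_def new_amsterdam_def)
  have N: "N > 0" using assms(1) by simp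
  have diam: "digraph_diameter (with_proj G) = enat k"
    using assms(4) by (simp add: G_def)
  then have upper: "digraph_diameter (with_proj A) \<le> enat (2 * k + 1)"
    using G.digraph_diameter_le_iff[of k] new_amsterdam_upper[OF N, where a = a and b = b and k = k]
    unfolding A.digraph_diameter_le_iff verts by (simp add: G_def A_def)
  \<comment> \<open>The upper bound makes the diameter finite, so the lower bound can be applied
    with \<open>d\<close> equal to the diameter itself.\<close>
  then obtain d where d: "digraph_diameter (with_proj A) = enat d"
    by (metis enat_ile)
  then have "digraph_diameter (with_proj G) \<le> enat (d div 2)"
    using A.digraph_diameter_le_iff[of d] new_amsterdam_lower[OF N, where a = a and b = b and d = d]
    unfolding G.digraph_diameter_le_iff verts by (simp add: G_def A_def)
  then have "2 * k \<le> d" using diam by simp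
  then show ?thesis using upper d by (simp add: A_def)
qed

end
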